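(* Let $\hat G$ be a looping of a finite simple graph $G$, let $\mathcal A$ be the zero-nonzero pattern of the (looped) adjacency matrix of $\hat G$, and let $R$ and $C$ be subsets of $V(G)$ with $|R|=|C|$. Then $\mathcal A[R,C]$ is a triangle if and only if $V(G)\setminus C$ is a loop zero forcing set for $\hat G$ from which $R$ can be the set of vertices that force.
   Context: A zero-nonzero pattern is a matrix with entries in $\{0,*\}$; a square pattern is a triangle if some permutation of its rows followed by some independent permutation of its columns yields a lower-triangular pattern with only $*$ entries on its diagonal. $\mathcal A[R,C]$ denotes the submatrix with rows indexed by $R$ and columns by $C$. A looping of $G$ is a loop graph obtained by adding loops to some vertices of $G$; the pattern of its looped adjacency matrix has $(i,j)$ entry $*$ iff $i,j$ are adjacent (for $i\ne j$) and diagonal entry $(i,i)$ equal to $*$ iff $i$ has a loop. Loop zero forcing rule: with some vertices filled, any vertex $v$ (filled or not) may force (fill) $u$ if $u$ is the unique unfilled neighbor of $v$ (a looped vertex is its own neighbor); each vertex forces at most once. A forcing sequence from $F$ is a sequence of forces each allowed by the rule when starting with $F$ filled and after the preceding forces have occurred; it is complete if no further force is possible afterwards. $F$ is a loop zero forcing set if repeated forcing fills all vertices. "$F$ is a loop zero forcing set from which $R$ can be the set of vertices that force" means $F$ is a loop zero forcing set and there is a complete forcing sequence from $F$ in which the set of vertices that force is exactly $R$. *)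

theory Defs
  imports
    "Graph_Theory.Pair_Digraph"
    "Jordan_Normal_Form.DL_Submatrix"
    "HOL-Combinatorics.Permutations"
begin

section \<open>Zero-nonzero patterns and triangles\<close>

datatype pattern_entry = Zero | Star

type_synonym pattern = "pattern_entry mat"

definition lower_triangular_pattern :: "pattern \<Rightarrow> bool" where
  "lower_triangular_pattern A \<longleftrightarrow>
     (\<forall>i < dim_row A. \<forall>j < dim_col A. i < j \<longrightarrow> A $$ (i, j) = Zero)"

definition permute_rows_cols :: "(nat \<Rightarrow> nat) \<Rightarrow> (nat \<Rightarrow> nat) \<Rightarrow> 'e mat \<Rightarrow> 'e mat" where
  "permute_rows_cols p q A = mat (dim_row A) (dim_col A) (\<lambda>(i, j). A $$ (p i, q j))"

definition triangle_pattern :: "pattern \<Rightarrow> bool" where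
  "triangle_pattern A \<longleftrightarrow> square_mat A \<and>
     (\<exists>p q. p permutes {..<dim_row A} \<and> q permutes {..<dim_col A} \<and>
        lower_triangular_pattern (permute_rows_cols p q A) \<and>
        (\<forall>i < dim_row A. permute_rows_cols p q A $$ (i, i) = Star))"

section \<open>Loop graphs\<close>

text \<open>
  A finite simple graph is a \<open>pair_graph\<close>: a finite loopless digraph whose arc relation is
  symmetric, an edge being represented by its two orientations. A loop graph is a
  \<open>pair_pre_digraph\<close> in which a loop at \<open>v\<close> is the arc \<open>(v, v)\<close>; hence the neighbors of \<open>v\<close>
  (which include \<open>v\<close> itself exactly when \<open>v\<close> has a loop) are the \<open>w\<close> with \<open>(v, w)\<close> an arc.
\<close>

definition looping_of :: "'a pair_pre_digraph \<Rightarrow> 'a pair_pre_digraph \<Rightarrow> bool" where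
  "looping_of H G \<longleftrightarrow>
     (\<exists>L \<subseteq> pverts G. H = \<lparr> pverts = pverts G, parcs = parcs G \<union> Id_on L \<rparr>)"

text \<open>
  Matrices here are indexed by natural numbers, so the adjacency pattern is taken with respect
  to a list \<open>vs\<close> enumerating the vertices: row and column \<open>i\<close> belong to the vertex \<open>vs ! i\<close>.
\<close>

definition adjacency_pattern :: "'a pair_pre_digraph \<Rightarrow> 'a list \<Rightarrow> pattern" where
  "adjacency_pattern H vs = mat (length vs) (length vs)
     (\<lambda>(i, j). if (vs ! i, vs ! j) \<in> parcs H then Star else Zero)"

definition positions :: "'a list \<Rightarrow> 'a set \<Rightarrow> nat set" where
  "positions vs S = {i. i < length vs \<and> vs ! i \<in> S}"

section \<open>Loop zero forcing\<close>

definition neighbors :: "'a pair_pre_digraph \<Rightarrow> 'a \<Rightarrow> 'a set" where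
  "neighbors H v = {w \<in> pverts H. (v, w) \<in> parcs H}"

definition can_force :: "'a pair_pre_digraph \<Rightarrow> 'a set \<Rightarrow> 'a \<Rightarrow> 'a \<Rightarrow> bool" where
  "can_force H B v u \<longleftrightarrow> v \<in> pverts H \<and> neighbors H v - B = {u}"

text \<open>
  A pair \<open>(v, u)\<close> in a list of forces means that \<open>v\<close> forces \<open>u\<close>; the first pair in the list
  is the first force performed.
\<close>

definition filled_after :: "'a set \<Rightarrow> ('a \<times> 'a) list \<Rightarrow> 'a set" where
  "filled_after F fs = F \<union> snd ` set fs"

definition forcing_vertices :: "('a \<times> 'a) list \<Rightarrow> 'a set" where
  "forcing_vertices fs = fst ` set fs"

inductive forcing_sequence :: "'a pair_pre_digraph \<Rightarrow> 'a set \<Rightarrow> ('a \<times> 'a) list \<Rightarrow> bool"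
  for H :: "'a pair_pre_digraph" and F :: "'a set"
where
  start: "forcing_sequence H F []"
| force: "\<lbrakk> forcing_sequence H F fs; v \<notin> forcing_vertices fs; can_force H (filled_after F fs) v u \<rbrakk>
    \<Longrightarrow> forcing_sequence H F (fs @ [(v, u)])"

definition complete_forcing_sequence ::
    "'a pair_pre_digraph \<Rightarrow> 'a set \<Rightarrow> ('a \<times> 'a) list \<Rightarrow> bool" where
  "complete_forcing_sequence H F fs \<longleftrightarrow>
     forcing_sequence H F fs \<and> (\<nexists>v u. forcing_sequence H F (fs @ [(v, u)]))"

definition loop_zero_forcing_set :: "'a pair_pre_digraph \<Rightarrow> 'a set \<Rightarrow> bool" where
  "loop_zero_forcing_set H F \<longleftrightarrow> F \<subseteq> pverts H \<and>
     (\<exists>fs. forcing_sequence H F fs \<and> filled_after F fs = pverts H)"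

definition can_be_forcing_vertices ::
    "'a pair_pre_digraph \<Rightarrow> 'a set \<Rightarrow> 'a set \<Rightarrow> bool" where
  "can_be_forcing_vertices H F R \<longleftrightarrow>
     (\<exists>fs. complete_forcing_sequence H F fs \<and> forcing_vertices fs = R)"

end

(* A force (v, u) is possible with unfilled set U exactly when row v of the pattern has, among
   the columns in U, its only star in column u. Starting from U = C, a sequence of card C forces
   is therefore the same thing as an ordering of R and of C making A[R,C] lower triangular, with
   the i-th force as the i-th diagonal entry. Forcing vertices are distinct and so are forced
   ones, so card R = card C makes a forcing sequence with forcing set R fill all of C. *)

theory Submission
  imports Defs
begin

lemma forcing_sequence_snoc_iff:
  "forcing_sequence H F (fs @ [(v, u)]) \<longleftrightarrow>
     forcing_sequence H F fs \<and> v \<notin> forcing_vertices fs \<and> can_force H (filled_after F fs) v u"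
    (is "?snoc \<longleftrightarrow> ?step")
proof
  assume ?snoc
  then show ?step by cases auto
next
  assume ?step
  then show ?snoc by (blast intro: forcing_sequence.force)
qed

text \<open>Forces are appended at the end, so the \<open>i\<close>-th one sees just what
  \<open>take i fs\<close> has filled. This trades the inductive definition for a condition on
  single indices, which can be compared with matrix rows.\<close>

lemma forcing_sequence_iff_nth:
  "forcing_sequence H F fs \<longleftrightarrow>
     distinct (map fst fs) \<and>
     (\<forall>i < length fs. can_force H (filled_after F (take i fs)) (fst (fs ! i)) (snd (fs ! i)))"
proof (induction fs rule: rev_induct)
  case Nil
  show ?case by (simp add: forcing_sequence.start)
next
  case (snoc p fs)
  obtain v u where "p = (v, u)" by (cases p)
  then show ?case
    using snoc.IH
    by (auto simp: forcing_sequence_snoc_iff forcing_vertices_def All_less_Suc nth_append)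
qed

text \<open>A vertex is unfilled when it is forced and stays filled from then on, so no vertex is
  forced twice and none lies in \<open>F\<close>.\<close>

lemma forcing_sequence_distinct_forced:
  assumes "forcing_sequence H F fs"
  shows "distinct (map snd fs) \<and> snd ` set fs \<subseteq> pverts H - F"
  using assms
  by induction (auto simp: can_force_def filled_after_def neighbors_def)

text \<open>The common form of both sides: \<open>f i\<close> and \<open>g i\<close> are the
  vertices of row and column \<open>i\<close> of the permuted triangle, and also the two ends of the
  \<open>i\<close>-th force. Neither \<open>vs\<close> nor submatrix indices occur.\<close>

definition triangular_enumeration ::
    "'a pair_pre_digraph \<Rightarrow> 'a set \<Rightarrow> 'a set \<Rightarrow> (nat \<Rightarrow> 'a) \<Rightarrow> (nat \<Rightarrow> 'a) \<Rightarrow> bool" where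
  "triangular_enumeration H R C f g \<longleftrightarrow>
     bij_betw f {..<card C} R \<and> bij_betw g {..<card C} C \<and>
     (\<forall>i < card C. (f i, g i) \<in> parcs H \<and>
        (\<forall>j < card C. i < j \<longrightarrow> (f i, g j) \<notin> parcs H))"

lemma forcing_iff_triangular_enumeration:
  assumes "finite C" "C \<subseteq> pverts H" "R \<subseteq> pverts H" "card R = card C"
  shows "loop_zero_forcing_set H (pverts H - C) \<and> can_be_forcing_vertices H (pverts H - C) R \<longleftrightarrow>
    (\<exists>f g. triangular_enumeration H R C f g)"
    (is "?forcing \<longleftrightarrow> ?enum")
proof
  assume ?forcing
  then obtain fs where fs: "forcing_sequence H (pverts H - C) fs" and R: "fst ` set fs = R"
    unfolding can_be_forcing_vertices_def complete_forcing_sequence_def forcing_vertices_def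
    by blast
  have dist_fst: "distinct (map fst fs)"
    and forces: "\<And>i. i < length fs \<Longrightarrow>
      can_force H (filled_after (pverts H - C) (take i fs)) (fst (fs ! i)) (snd (fs ! i))"
    using fs unfolding forcing_sequence_iff_nth by auto
  have dist_snd: "distinct (map snd fs)" and sub: "snd ` set fs \<subseteq> C"
    using forcing_sequence_distinct_forced[OF fs] by auto
  have len: "length fs = card C"
    using distinct_card[OF dist_fst] R assms(4) by simp
  have C: "snd ` set fs = C"
    using card_subset_eq[OF assms(1) sub] distinct_card[OF dist_snd] len by simp
  let ?f = "\<lambda>i. fst (fs ! i)" and ?g = "\<lambda>i. snd (fs ! i)"
  have "bij_betw (nth (map fst fs)) {..<card C} R" "bij_betw (nth (map snd fs)) {..<card C} C"
    by (intro bij_betw_nth; simp add: R C len dist_fst dist_snd)+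
  then have "bij_betw ?f {..<card C} R" "bij_betw ?g {..<card C} C"
    by (auto elim!: bij_betw_cong[THEN iffD1, rotated] simp: len)
  moreover have "(?f i, ?g i) \<in> parcs H" if "i < card C" for i
    using forces[of i] that unfolding len can_force_def neighbors_def by blast
  moreover have "(?f i, ?g j) \<notin> parcs H" if "i < j" "j < card C" for i j
  proof
    \<comment> \<open>Since \<open>?g j\<close> is forced later than step \<open>i\<close>, it would
      be a second unfilled neighbor of \<open>?f i\<close> at that step.\<close>
    assume arc: "(?f i, ?g j) \<in> parcs H"
    have gj: "?g j \<in> C"
      using that len nth_mem[of j fs] unfolding C[symmetric] by (intro imageI) simp
    \<comment> \<open>Including index \<open>i\<close> gives two facts at once: \<open>?g j\<close>
      is not yet filled, and it is not the vertex being forced.\<close>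
    have "?g j \<notin> ?g ` {..i}"
      using dist_snd that len by (auto simp: distinct_conv_nth)
    moreover have "snd ` set (take i fs) = ?g ` {..<i}"
      using that len by (simp add: image_image lessThan_atLeast0 flip: nth_image)
    moreover have "?g ` {..<i} \<subseteq> ?g ` {..i}" "?g i \<in> ?g ` {..i}"
      by auto
    ultimately have "?g j \<notin> snd ` set (take i fs)" "?g j \<noteq> ?g i"
      by (blast, metis)
    moreover have "neighbors H (?f i) - filled_after (pverts H - C) (take i fs) = {?g i}"
      using forces[of i] that len by (simp add: can_force_def)
    moreover have "?g j \<in> neighbors H (?f i)"
      using arc gj assms(2) unfolding neighbors_def by blast
    ultimately show False
      using gj unfolding filled_after_def by blast
  qed
  ultimately have "triangular_enumeration H R C ?f ?g"
    unfolding triangular_enumeration_def by blast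
  then show ?enum by blast
next
  assume ?enum
  then obtain f g where f: "bij_betw f {..<card C} R" and g: "bij_betw g {..<card C} C"
    and arcs: "\<forall>i < card C. (f i, g i) \<in> parcs H \<and>
          (\<forall>j < card C. i < j \<longrightarrow> (f i, g j) \<notin> parcs H)"
    unfolding triangular_enumeration_def by blast
  have diag: "(f i, g i) \<in> parcs H" if "i < card C" for i
    using arcs that by blast
  have above: "(f i, g j) \<notin> parcs H" if "i < j" "j < card C" for i j
    using arcs that less_trans by blast
  \<comment> \<open>The forces read the diagonal from top to bottom.\<close>
  let ?fs = "map (\<lambda>i. (f i, g i)) [0..<card C]"
  have f_in: "f i \<in> pverts H" if "i < card C" for i
    using f assms(3) that by (auto simp: bij_betw_def)
  have filled: "filled_after (pverts H - C) (take i ?fs) = (pverts H - C) \<union> g ` {..<i}"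
    if "i \<le> card C" for i
    using that by (auto simp: filled_after_def take_map image_image lessThan_atLeast0)
  \<comment> \<open>By injectivity of \<open>g\<close>, the vertices unfilled before force
    \<open>i\<close> are those of the columns from \<open>i\<close> on.\<close>
  have unfilled: "C - g ` {..<i} = g ` {i..<card C}" if "i \<le> card C" for i
  proof -
    have "C - g ` {..<i} = g ` {..<card C} - g ` {..<i}"
      using g by (simp add: bij_betw_def)
    also have "\<dots> = g ` ({..<card C} - {..<i})"
      using g that by (intro inj_on_image_set_diff[symmetric]) (auto simp: bij_betw_def)
    also have "{..<card C} - {..<i} = {i..<card C}" by auto
    finally show ?thesis .
  qed
  have seq: "forcing_sequence H (pverts H - C) ?fs"
    unfolding forcing_sequence_iff_nth
  proof (intro conjI allI impI)
    show "distinct (map fst ?fs)"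
      using f by (auto simp: bij_betw_def distinct_map inj_on_def)
  next
    fix i assume "i < length ?fs"
    then have i: "i < card C" by simp
    have "neighbors H (f i) - (pverts H - C \<union> g ` {..<i}) = {w \<in> g ` {i..<card C}. (f i, w) \<in> parcs H}"
      using unfilled[of i] i assms(2) by (auto simp: neighbors_def)
    \<comment> \<open>In these columns row \<open>i\<close> has its diagonal star and, by
      \<open>above\<close>, only zeros to the right of it.\<close>
    also have "\<dots> = {g i}"
      using diag[OF i] above[of i] i by (auto simp: order.order_iff_strict)
    finally show "can_force H (filled_after (pverts H - C) (take i ?fs)) (fst (?fs ! i)) (snd (?fs ! i))"
      using i f_in filled[of i] by (simp add: can_force_def)
  qed
  have all: "filled_after (pverts H - C) ?fs = pverts H"
    using filled[of "card C"] g assms(2) by (auto simp: bij_betw_def)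
  \<comment> \<open>Once everything is filled, no vertex has an unfilled neighbor left to
    force.\<close>
  have "complete_forcing_sequence H (pverts H - C) ?fs"
    unfolding complete_forcing_sequence_def forcing_sequence_snoc_iff
    using seq all by (auto simp: can_force_def neighbors_def)
  moreover have "forcing_vertices ?fs = R"
    using f by (auto simp: forcing_vertices_def bij_betw_def image_image lessThan_atLeast0)
  ultimately show ?forcing
    using seq all unfolding loop_zero_forcing_set_def can_be_forcing_vertices_def by blast
qed

lemma bij_betw_factor_permutes:
  assumes "bij_betw f A B" "bij_betw h A B"
  obtains p where "p permutes A" "\<And>x. x \<in> A \<Longrightarrow> f x = h (p x)"
proof
  \<comment> \<open>This is the inverse of \<open>h\<close> after \<open>f\<close>, extended by the
    identity because \<open>permutes\<close> fixes all points outside \<open>A\<close>.\<close>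
  let ?p = "\<lambda>x. if x \<in> A then inv_into A h (f x) else x"
  have "bij_betw (inv_into A h \<circ> f) A A"
    using assms bij_betw_inv_into bij_betw_trans by blast
  then have "bij_betw ?p A A"
    by (auto cong: bij_betw_cong)
  then show "?p permutes A"
    by (auto intro: bij_imp_permutes)
  show "f x = h (?p x)" if "x \<in> A" for x
    using assms that bij_betwE by (fastforce simp: bij_betw_inv_into_right)
qed

text \<open>\<open>pick I\<close> lists \<open>I\<close> in increasing order: strict monotonicity
  gives injectivity, and counting gives surjectivity.\<close>

lemma bij_betw_pick:
  assumes "finite I"
  shows "bij_betw (pick I) {..<card I} I"
proof -
  have inj: "inj_on (pick I) {..<card I}"
    by (auto intro!: linorder_inj_onI' dest: pick_mono_le)
  have "pick I ` {..<card I} \<subseteq> I"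
    by (auto intro: pick_in_set_le)
  then have "pick I ` {..<card I} = I"
    using assms inj by (intro card_subset_eq) (auto simp: card_image)
  with inj show ?thesis by (simp add: bij_betw_def)
qed

lemma bij_betw_nth_positions:
  assumes "distinct vs" "S \<subseteq> set vs"
  shows "bij_betw (nth vs) (positions vs S) S"
proof (rule bij_betw_imageI)
  show "inj_on (nth vs) (positions vs S)"
    using assms(1) by (auto simp: inj_on_def positions_def nth_eq_iff_index_eq)
  show "nth vs ` positions vs S = S"
    using assms(2) by (auto simp: positions_def image_iff) (metis in_set_conv_nth subsetD)
qed

text \<open>The submatrix comes with one fixed enumeration of \<open>R\<close> and one of
  \<open>C\<close>. All others arise from these by permuting indices, so choosing row and column
  permutations amounts to choosing \<open>f\<close> and \<open>g\<close>.\<close>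

lemma triangle_submatrix_iff_enumeration:
  assumes "distinct vs" "R \<subseteq> set vs" "C \<subseteq> set vs" "card R = card C"
  shows "triangle_pattern (submatrix (adjacency_pattern H vs) (positions vs R) (positions vs C)) \<longleftrightarrow>
    (\<exists>f g. triangular_enumeration H R C f g)"
    (is "triangle_pattern ?M \<longleftrightarrow> ?enum")
proof -
  \<comment> \<open>\<open>r i\<close> and \<open>c j\<close> are the vertices to which row
    \<open>i\<close> and column \<open>j\<close> of the submatrix belong.\<close>
  define r where "r = nth vs \<circ> pick (positions vs R)"
  define c where "c = nth vs \<circ> pick (positions vs C)"
  have fin: "finite (positions vs S)" for S
    by (simp add: positions_def)
  have card_pos: "card (positions vs S) = card S" if "S \<subseteq> set vs" for S
    using bij_betw_nth_positions[OF assms(1) that] by (rule bij_betw_same_card)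
  have r: "bij_betw r {..<card C} R" and c: "bij_betw c {..<card C} C"
    unfolding r_def c_def
    using bij_betw_trans[OF bij_betw_pick[OF fin] bij_betw_nth_positions[OF assms(1,2)]]
      bij_betw_trans[OF bij_betw_pick[OF fin] bij_betw_nth_positions[OF assms(1,3)]]
    by (simp_all add: card_pos assms)
  have dims: "{i. i < length vs \<and> i \<in> positions vs S} = positions vs S" for S
    by (auto simp: positions_def)
  \<comment> \<open>Here \<open>card R = card C\<close> makes the submatrix square, as a triangle
    must be.\<close>
  have dim: "dim_row ?M = card C" "dim_col ?M = card C"
    by (simp_all add: dim_submatrix adjacency_pattern_def dims card_pos assms)
  have positions_less: "i < length vs" if "i \<in> positions vs S" for i S
    using that by (simp add: positions_def)
  have entry: "?M $$ (i, j) = (if (r i, c j) \<in> parcs H then Star else Zero)"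
    if "i < card C" "j < card C" for i j
  proof -
    have "pick (positions vs R) i \<in> positions vs R" "pick (positions vs C) j \<in> positions vs C"
      using that by (auto intro!: pick_in_set_le simp: card_pos assms)
    then show ?thesis
      using that
      by (simp add: submatrix_index adjacency_pattern_def dims card_pos assms r_def c_def
          positions_less)
  qed
  have tri: "triangle_pattern ?M \<longleftrightarrow>
    (\<exists>p q. p permutes {..<card C} \<and> q permutes {..<card C} \<and>
       (\<forall>i < card C. (r (p i), c (q i)) \<in> parcs H \<and>
          (\<forall>j < card C. i < j \<longrightarrow> (r (p i), c (q j)) \<notin> parcs H)))"
  proof -
    \<comment> \<open>Permuted indices stay in range, so \<open>entry\<close> applies to the
      permuted matrix.\<close>
    have "p i < card C" if "p permutes {..<card C}" "i < card C" for p i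
      using permutes_in_image[OF that(1)] that(2) by simp
    then show ?thesis
      unfolding triangle_pattern_def lower_triangular_pattern_def permute_rows_cols_def
        square_mat.simps dim simp_thms
      by (intro iff_exI) (auto simp: dim entry split: if_splits)
  qed
  show ?thesis
  proof
    assume "triangle_pattern ?M"
    then obtain p q where "p permutes {..<card C}" "q permutes {..<card C}"
      and *: "\<forall>i < card C. (r (p i), c (q i)) \<in> parcs H \<and>
          (\<forall>j < card C. i < j \<longrightarrow> (r (p i), c (q j)) \<notin> parcs H)"
      unfolding tri by blast
    then have "bij_betw (r \<circ> p) {..<card C} R" "bij_betw (c \<circ> q) {..<card C} C"
      using r c permutes_imp_bij bij_betw_trans by blast+
    with * have "triangular_enumeration H R C (r \<circ> p) (c \<circ> q)"
      by (simp add: triangular_enumeration_def)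
    then show ?enum by blast
  next
    assume ?enum
    then obtain f g where f: "bij_betw f {..<card C} R" and g: "bij_betw g {..<card C} C"
      and *: "\<forall>i < card C. (f i, g i) \<in> parcs H \<and>
          (\<forall>j < card C. i < j \<longrightarrow> (f i, g j) \<notin> parcs H)"
      unfolding triangular_enumeration_def by blast
    \<comment> \<open>The row permutation measures how \<open>f\<close> reorders \<open>r\<close>;
      likewise for \<open>g\<close> and \<open>c\<close>.\<close>
    obtain p where p: "p permutes {..<card C}" "\<And>i. i \<in> {..<card C} \<Longrightarrow> f i = r (p i)"
      using bij_betw_factor_permutes[OF f r] by blast
    obtain q where q: "q permutes {..<card C}" "\<And>i. i \<in> {..<card C} \<Longrightarrow> g i = c (q i)"
      using bij_betw_factor_permutes[OF g c] by blast
    have "\<forall>i < card C. (r (p i), c (q i)) \<in> parcs H \<and>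
          (\<forall>j < card C. i < j \<longrightarrow> (r (p i), c (q j)) \<notin> parcs H)"
      using * p(2) q(2) by simp
    then show "triangle_pattern ?M"
      unfolding tri using p(1) q(1) by blast
  qed
qed

theorem theorem2p3:
  fixes G Ghat :: "'a pair_pre_digraph" and vs :: "'a list" and R C :: "'a set"
  assumes "pair_graph G"
    and "looping_of Ghat G"
    and "distinct vs" and "set vs = pverts G"
    and "R \<subseteq> pverts G" and "C \<subseteq> pverts G" and "card R = card C"
  shows "triangle_pattern (submatrix (adjacency_pattern Ghat vs) (positions vs R) (positions vs C)) \<longleftrightarrow>
    loop_zero_forcing_set Ghat (pverts G - C) \<and> can_be_forcing_vertices Ghat (pverts G - C) R"
proof -
  \<comment> \<open>A looping adds arcs only, so complements in \<open>G\<close> and in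
    \<open>Ghat\<close> agree.\<close>
  have verts: "pverts Ghat = pverts G"
    using assms(2) by (auto simp: looping_of_def)
  have "finite C"
    using assms(4,6) by (metis finite_set finite_subset)
  then have "loop_zero_forcing_set Ghat (pverts G - C) \<and> can_be_forcing_vertices Ghat (pverts G - C) R \<longleftrightarrow>
    (\<exists>f g. triangular_enumeration Ghat R C f g)"
    using forcing_iff_triangular_enumeration[of C Ghat R] assms(5-7) by (simp add: verts)
  then show ?thesis
    using triangle_submatrix_iff_enumeration[of vs R C Ghat] assms(3-7) by simp
qed

end
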